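(* For binary words $w_1,w_2$, we have $[\sigma(w_1)] = [\sigma(w_2)]$ if and only if either $w_1 = w_2$, or there exist $a,b \geq 0$ such that $\{w_1,w_2\} = \{0^{a+1}1^b,\ 1^{b+1}0^a\}$.
   Context: For a binary word $w=w_1\cdots w_{n-1}$, the permutation $\sigma(w)=\sigma_1\cdots\sigma_n$ of $[n]$ is defined by: for $k=1,\dots,n-1$, $\sigma_k$ is the minimum of $[n]\setminus\{\sigma_1,\dots,\sigma_{k-1}\}$ if $w_k=0$ and the maximum of this set if $w_k=1$; $\sigma_n$ is the remaining element. A circular permutation $[\pi]$ is the set of all rotations of the permutation $\pi$. *)

theory Defs
  imports Main
begin

text \<open>
  Binary words are lists of booleans, \<^const>\<open>False\<close> standing for the letter 0 and
  \<^const>\<open>True\<close> for the letter 1.  Permutations of \<open>[n] = {1, \<dots>, n}\<close> are lists in one-line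
  notation.
\<close>

text \<open>
  \<open>sigma_from S w\<close> expects \<open>card S = length w + 1\<close>, where \<open>S\<close> is the set of values not
  yet used: each letter takes the minimum or maximum of \<open>S\<close>, and \<open>S\<close> is a singleton when
  the word is exhausted.
\<close>

fun sigma_from :: "nat set \<Rightarrow> bool list \<Rightarrow> nat list" where
  "sigma_from S [] = [the_elem S]"
| "sigma_from S (c # w) =
     (let m = (if c then Max S else Min S) in m # sigma_from (S - {m}) w)"

definition sigma :: "bool list \<Rightarrow> nat list" where
  "sigma w = sigma_from {1..length w + 1} w"

definition circular_perm :: "'a list \<Rightarrow> 'a list set" where
  "circular_perm p = {rotate k p | k. True}"

lemma sigma_from_perm:
  assumes "finite S" "card S = length w + 1"
  shows "distinct (sigma_from S w) \<and> set (sigma_from S w) = S"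
  using assms
proof (induction w arbitrary: S)
  case Nil
  then obtain x where "S = {x}"
    by (auto simp: card_1_singleton_iff)
  then show ?case by simp
next
  case (Cons c w)
  define m where "m = (if c then Max S else Min S)"
  have "S \<noteq> {}" using Cons.prems by auto
  then have m: "m \<in> S" using Cons.prems by (simp add: m_def)
  then have "card (S - {m}) = length w + 1" using Cons.prems by simp
  then have "distinct (sigma_from (S - {m}) w) \<and> set (sigma_from (S - {m}) w) = S - {m}"
    using Cons by simp
  moreover have "sigma_from S (c # w) = m # sigma_from (S - {m}) w"
    by (simp add: m_def Let_def)
  ultimately show ?case using m by auto
qed

lemma sigma_perm: "distinct (sigma w) \<and> set (sigma w) = {1..length w + 1}"
  unfolding sigma_def by (rule sigma_from_perm) simp_all

end

theory Submission
  imports Defs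
begin

text \<open>
  Suppose \<open>\<sigma>(w1) = A B\<close> and \<open>\<sigma>(w2) = B A\<close> with both blocks nonempty, and say \<open>1\<close> lies in \<open>A\<close>.
  The prefix \<open>B\<close> of \<open>\<sigma>(w2)\<close> never takes the minimum, so it is \<open>n, n-1, \<dots>\<close>; in particular \<open>n\<close>
  lies in \<open>B\<close>, so the prefix \<open>A\<close> of \<open>\<sigma>(w1)\<close> never takes the maximum and is \<open>1, 2, \<dots>\<close>.
  Hence both permutations, and by injectivity of \<open>\<sigma>\<close> both words, are determined by the
  lengths of the blocks.
\<close>

declare sigma_from.simps(2) [simp del]

abbreviation sigma_at :: "nat \<Rightarrow> bool list \<Rightarrow> nat list" where
  "sigma_at l w \<equiv> sigma_from {l..l + length w} w"

lemma length_sigma_from [simp]: "length (sigma_from S w) = Suc (length w)"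
  by (induction w arbitrary: S) (simp_all add: sigma_from.simps(2) Let_def)

lemma sigma_eq_sigma_at: "sigma w = sigma_at 1 w"
  by (simp add: sigma_def)

lemma sigma_at_True: "sigma_at l (True # w) = Suc (l + length w) # sigma_at l w"
proof -
  have "Max {l..Suc (l + length w)} = Suc (l + length w)"
    by (rule Max_eqI) auto
  moreover have "{l..Suc (l + length w)} - {Suc (l + length w)} = {l..l + length w}"
    by auto
  ultimately show ?thesis by (simp add: sigma_from.simps(2) Let_def)
qed

lemma sigma_at_False: "sigma_at l (False # w) = l # sigma_at (Suc l) w"
proof -
  have "Min {l..Suc (l + length w)} = l"
    by (rule Min_eqI) auto
  moreover have "{l..Suc (l + length w)} - {l} = {Suc l..Suc (l + length w)}"
    by auto
  ultimately show ?thesis by (simp add: sigma_from.simps(2) Let_def)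
qed

text \<open>The first letter can be read off the head, which is one of the two distinct ends of the
  interval; the tails then start from the same smaller interval.\<close>

lemma sigma_at_inj: "sigma_at l v = sigma_at l w \<Longrightarrow> v = w"
proof (induction v arbitrary: l w)
  case Nil
  from arg_cong[OF this, of length] have "length w = 0" by simp
  then show ?case by simp
next
  case (Cons c v)
  have len: "length w = Suc (length v)"
    using arg_cong[OF Cons.prems, of length] by simp
  then obtain d w' where w: "w = d # w'" and len': "length w' = length v"
    by (cases w) auto
  have eq: "sigma_at l (c # v) = sigma_at l (d # w')"
    using Cons.prems by (simp only: w)
  have "c = d"
    using arg_cong[OF eq, of hd] len'
    by (cases c; cases d; simp only: sigma_at_True sigma_at_False list.sel; simp?)
  moreover have "v = w'"
  proof (cases c)
    case True
    with eq \<open>c = d\<close> have "sigma_at l v = sigma_at l w'"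
      by (simp only: sigma_at_True list.inject)
    then show ?thesis by (rule Cons.IH)
  next
    case False
    with eq \<open>c = d\<close> have "sigma_at (Suc l) v = sigma_at (Suc l) w'"
      by (simp only: sigma_at_False list.inject)
    then show ?thesis by (rule Cons.IH)
  qed
  ultimately show ?case by (simp add: w)
qed

lemma sigma_at_replicate_False_append:
  "sigma_at l (replicate a False @ v) = [l..<l + a] @ sigma_at (l + a) v"
proof (induction a arbitrary: l)
  case (Suc a)
  then show ?case
    by (simp only: replicate_Suc append_Cons sigma_at_False) (simp add: upt_rec[of l])
qed simp

lemma sigma_at_replicate_True_append:
  "sigma_at l (replicate b True @ v) =
    rev [Suc (l + length v)..<Suc (l + length v + b)] @ sigma_at l v"
proof (induction b)
  case (Suc b)
  then show ?case
    by (simp only: replicate_Suc append_Cons sigma_at_True) (simp add: ac_simps)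
qed simp

lemma sigma_at_replicate_False: "sigma_at l (replicate a False) = [l..<Suc (l + a)]"
  using sigma_at_replicate_False_append[of l a "[]"] by simp

lemma sigma_at_replicate_True: "sigma_at l (replicate b True) = rev [l..<Suc (l + b)]"
  \<comment> \<open>The leftover value \<open>l\<close> continues the descending run;
    \<open>upt_rec\<close> splits it off.\<close>
  using sigma_at_replicate_True_append[of l b "[]"] by (simp add: upt_rec[of l])

text \<open>A letter \<open>False\<close> keeps the upper end \<open>l + length w\<close> fixed, so
  the hypothesis on \<open>X\<close> passes to the tail. As \<open>Y\<close> is nonempty, every
  entry of \<open>X\<close> comes from a letter and none is the leftover value.\<close>

lemma sigma_at_prefix_without_max:
  assumes "sigma_at l w = X @ Y" "Y \<noteq> []" "l + length w \<notin> set X"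
  shows "take (length X) w = replicate (length X) False"
  using assms
proof (induction X arbitrary: l w)
  case (Cons x X)
  have "length w = length X + length Y"
    using arg_cong[OF Cons.prems(1), of length] by simp
  then obtain c v where w: "w = c # v"
    using Cons.prems(2) by (cases w) auto
  have "\<not> c"
  proof
    assume "c"
    then have "x = l + length w"
      using Cons.prems(1) by (simp only: w sigma_at_True) simp
    then show False using Cons.prems(3) by simp
  qed
  then have "sigma_at (Suc l) v = X @ Y"
    using Cons.prems(1) by (auto simp only: w sigma_at_False append_Cons list.inject)
  with Cons.IH[of "Suc l" v] Cons.prems \<open>\<not> c\<close> show ?case
    by (simp add: w)
qed simp

text \<open>Dual to the previous lemma; a letter \<open>True\<close> keeps the lower end, so
  \<open>l\<close> stays fixed in the induction.\<close>

lemma sigma_at_prefix_without_min: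
  assumes "sigma_at l w = X @ Y" "Y \<noteq> []" "l \<notin> set X"
  shows "take (length X) w = replicate (length X) True"
  using assms
proof (induction X arbitrary: w)
  case (Cons x X)
  have "length w = length X + length Y"
    using arg_cong[OF Cons.prems(1), of length] by simp
  then obtain c v where w: "w = c # v"
    using Cons.prems(2) by (cases w) auto
  have c
  proof (rule ccontr)
    assume "\<not> c"
    then have "x = l"
      using Cons.prems(1) by (simp only: w sigma_at_False) simp
    then show False using Cons.prems(3) by simp
  qed
  then have "sigma_at l v = X @ Y"
    using Cons.prems(1) by (auto simp only: w sigma_at_True append_Cons list.inject)
  with Cons.IH[of v] Cons.prems \<open>c\<close> show ?case
    by (simp add: w)
qed simp

lemma sigma_block_swap:
  assumes AB: "sigma w1 = A @ B" and BA: "sigma w2 = B @ A"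
    and "B \<noteq> []" and one: "1 \<in> set A"
  obtains a b where "w1 = replicate (a + 1) False @ replicate b True"
    and "w2 = replicate (b + 1) True @ replicate a False"
proof -
  define n where "n = Suc (length w1)"
  have n1: "n = length A + length B"
    using arg_cong[OF AB, of length] by (simp add: n_def sigma_def)
  then have n2: "n = Suc (length w2)"
    using arg_cong[OF BA, of length] by (simp add: sigma_def)
  \<comment> \<open>The last block of a permutation contains the leftover value, which no letter
    produces, so it accounts for one letter fewer than its length.\<close>
  obtain a where a: "length A = Suc a"
    using one by (cases A) auto
  obtain b where b: "length B = Suc b"
    using \<open>B \<noteq> []\<close> by (cases B) auto
  have "A \<noteq> []" using one by auto
  have disj: "set A \<inter> set B = {}"
    using sigma_perm[of w1] AB by auto
  have "take (length B) w2 = replicate (length B) True"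
    using sigma_at_prefix_without_min[of 1 w2 B A] BA one disj \<open>A \<noteq> []\<close>
    by (auto simp: sigma_eq_sigma_at)
  then obtain v2 where w2: "w2 = replicate (Suc b) True @ v2"
    by (metis append_take_drop_id b)
  have v2: "length v2 = a"
    using w2 n1 n2 a b by simp
  have "B @ A = rev [Suc (1 + a)..<Suc (1 + a + Suc b)] @ sigma_at 1 v2"
    using BA sigma_at_replicate_True_append[of 1 "Suc b" v2] v2
    by (simp only: sigma_eq_sigma_at w2)
  \<comment> \<open>\<open>B\<close> and the descending run both have length \<open>b + 1\<close>,
    so the equation splits blockwise.\<close>
  then have B: "B = rev [a + 2..<a + b + 3]" and A: "A = sigma_at 1 v2"
    using b by (simp_all add: numeral_eq_Suc del: upt_Suc)
  have "n \<in> set B"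
    using n1 a b by (simp add: B)
  then have "take (length A) w1 = replicate (length A) False"
    using sigma_at_prefix_without_max[of 1 w1 A B] AB disj \<open>B \<noteq> []\<close>
    by (auto simp: sigma_eq_sigma_at n_def)
  then obtain v1 where w1: "w1 = replicate (Suc a) False @ v1"
    by (metis append_take_drop_id a)
  have "A @ B = [1..<1 + Suc a] @ sigma_at (1 + Suc a) v1"
    using AB sigma_at_replicate_False_append[of 1 "Suc a" v1]
    by (simp only: sigma_eq_sigma_at w1)
  then have A': "A = [1..<1 + Suc a]" and B': "B = sigma_at (1 + Suc a) v1"
    using a by (simp_all del: upt_Suc)
  \<comment> \<open>The word \<open>w2\<close> fixed \<open>B\<close> as a descending run, which is
    also the output of \<open>replicate b True\<close>; injectivity then identifies
    \<open>v1\<close>. The block \<open>A\<close>, fixed by \<open>w1\<close>, identifies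
    \<open>v2\<close> likewise.\<close>
  have "sigma_at (1 + Suc a) v1 = sigma_at (1 + Suc a) (replicate b True)"
    unfolding sigma_at_replicate_True B'[symmetric] B by (simp add: numeral_eq_Suc)
  then have "v1 = replicate b True" by (rule sigma_at_inj)
  moreover have "sigma_at 1 v2 = sigma_at 1 (replicate a False)"
    unfolding sigma_at_replicate_False A[symmetric] A' by simp
  then have "v2 = replicate a False" by (rule sigma_at_inj)
  ultimately show ?thesis using that[of a b] w1 w2 by simp
qed

lemma circular_perm_append_commute: "circular_perm (X @ Y) = circular_perm (Y @ X)"
proof -
  have "circular_perm (V @ U) \<subseteq> circular_perm (U @ V)" for U V :: "'a list"
  proof
    fix q assume "q \<in> circular_perm (V @ U)"
    then obtain k where "q = rotate k (V @ U)"
      by (auto simp: circular_perm_def)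
    also have "V @ U = rotate (length U) (U @ V)"
      by (simp only: rotate_append)
    finally have "q = rotate (k + length U) (U @ V)"
      by (simp only: rotate_rotate)
    then show "q \<in> circular_perm (U @ V)"
      unfolding circular_perm_def by blast
  qed
  then show ?thesis by (meson subset_antisym)
qed

lemma circular_perm_eq_blocks:
  assumes "circular_perm p = circular_perm q" "p \<noteq> q"
  obtains A B where "A \<noteq> []" "B \<noteq> []" "p = A @ B" "q = B @ A"
proof -
  have "q \<in> circular_perm q"
    by (auto simp: circular_perm_def intro: exI[of _ 0])
  then obtain k where k: "q = rotate k p"
    using assms(1) by (auto simp: circular_perm_def)
  define j where "j = k mod length p"
  have q: "q = drop j p @ take j p"
    by (simp add: k j_def rotate_drop_take)
  \<comment> \<open>If either piece were empty, the rotation would be trivial and \<open>q\<close>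
    would equal \<open>p\<close>.\<close>
  have "take j p \<noteq> []" "drop j p \<noteq> []"
    using q \<open>p \<noteq> q\<close> by (metis append_Nil append_Nil2 append_take_drop_id)+
  then show ?thesis
    using that[of "take j p" "drop j p"] q by simp
qed

text \<open>Both permutations consist of the increasing block \<open>1, ..., a + 1\<close> and the
  decreasing block \<open>a + b + 2, ..., a + 2\<close>, in opposite orders.\<close>

lemma circular_perm_sigma_exceptional:
  "circular_perm (sigma (replicate (a + 1) False @ replicate b True)) =
   circular_perm (sigma (replicate (b + 1) True @ replicate a False))"
proof -
  have "sigma (replicate (a + 1) False @ replicate b True) =
      [1..<a + 2] @ rev [a + 2..<a + b + 3]"
    unfolding sigma_eq_sigma_at sigma_at_replicate_False_append sigma_at_replicate_True
    by (simp add: numeral_eq_Suc)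
  moreover have "sigma (replicate (b + 1) True @ replicate a False) =
      rev [a + 2..<a + b + 3] @ [1..<a + 2]"
    unfolding sigma_eq_sigma_at sigma_at_replicate_True_append sigma_at_replicate_False
    by (simp add: numeral_eq_Suc)
  ultimately show ?thesis
    by (metis circular_perm_append_commute)
qed

theorem theorem3p6:
  fixes w1 w2 :: "bool list"
  shows "circular_perm (sigma w1) = circular_perm (sigma w2) \<longleftrightarrow>
    w1 = w2 \<or>
    (\<exists>a b :: nat. {w1, w2} =
      {replicate (a + 1) False @ replicate b True,
       replicate (b + 1) True @ replicate a False})"
proof
  assume eq: "circular_perm (sigma w1) = circular_perm (sigma w2)"
  show "w1 = w2 \<or> (\<exists>a b :: nat. {w1, w2} =
      {replicate (a + 1) False @ replicate b True,
       replicate (b + 1) True @ replicate a False})"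
  proof (cases "sigma w1 = sigma w2")
    case True
    then have "w1 = w2"
      unfolding sigma_eq_sigma_at by (rule sigma_at_inj)
    then show ?thesis ..
  next
    case False
    with eq obtain A B where ne: "A \<noteq> []" "B \<noteq> []"
      and AB: "sigma w1 = A @ B" and BA: "sigma w2 = B @ A"
      by (rule circular_perm_eq_blocks)
    have "1 \<in> set A \<union> set B"
      using sigma_perm[of w1] AB by auto
    then consider "1 \<in> set A" | "1 \<in> set B" by blast
    then show ?thesis
    proof cases
      case 1
      from sigma_block_swap[OF AB BA ne(2) this] obtain a b where
        "w1 = replicate (a + 1) False @ replicate b True"
        "w2 = replicate (b + 1) True @ replicate a False" .
      then show ?thesis by blast
    next
      case 2
      \<comment> \<open>With \<open>1\<close> in \<open>B\<close> the two words exchange roles,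
        which the unordered pair absorbs.\<close>
      from sigma_block_swap[OF BA AB ne(1) this] obtain a b where
        "w2 = replicate (a + 1) False @ replicate b True"
        "w1 = replicate (b + 1) True @ replicate a False" .
      then show ?thesis by blast
    qed
  qed
next
  assume "w1 = w2 \<or> (\<exists>a b :: nat. {w1, w2} =
      {replicate (a + 1) False @ replicate b True,
       replicate (b + 1) True @ replicate a False})"
  then show "circular_perm (sigma w1) = circular_perm (sigma w2)"
    unfolding doubleton_eq_iff using circular_perm_sigma_exceptional by blast
qed

end
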